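(* Let $R$ be a finite commutative von Neumann regular ring. The following statements hold. 1. The graph $\Gamma'_{Reg}(R)$ is a path graph if and only if $R\cong\mathbb{F}_2\times\mathbb{F}_2$ or $R\cong\mathbb{F}_2\times\mathbb{F}_3$. 2. The graph $\Gamma'_{Reg}(R)$ is a cycle graph if and only if $R\cong\mathbb{F}_3\times\mathbb{F}_3$. 3. The graph $\Gamma'_{Reg}(R)$ is a wheel graph if and only if $R\cong\mathbb{F}_2\times\mathbb{F}_2\times\mathbb{F}_2$.
   Context: All rings have an identity. A ring $R$ is von Neumann regular if for every $x\in R$ there is $y\in R$ with $xyx=x$. For such $R$, $\Gamma'_{Reg}(R)$ is the simple graph with vertex set $R\setminus\{0_R\}$ in which two distinct vertices $a,b$ are adjacent if and only if $aba=a$ or $bab=b$. A path graph $P_n$ is a graph isomorphic to the graph with vertex set $\{v_1,\dots,v_n\}$ and edge set $\{v_iv_{i+1}\mid 1\le i\le n-1\}$. A cycle graph $C_n$, $n\ge 3$, is a graph isomorphic to the graph with vertex set $\{v_1,\dots,v_n\}$ and edge set $\{v_iv_{i+1}\mid 1\le i\le n-1\}\cup\{v_nv_1\}$. A wheel graph $W_n$ is obtained from a cycle graph $C_n$ by adding a new vertex adjacent to every vertex of the cycle. $\mathbb{F}_q$ denotes the field with $q$ elements.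
   Formalization: Path graphs are required to have at least two vertices: if the one-vertex path P_1 were allowed, item 1 would fail for R = F_2, whose graph is the single vertex 1. *)

theory Defs
  imports
    "HOL-Algebra.Algebra"
    "HOL-Number_Theory.Residues"
    "Graph_Theory.Graph_Theory"
begin

definition von_neumann_regular :: "('a, 'm) ring_scheme \<Rightarrow> bool" where
  "von_neumann_regular R \<longleftrightarrow>
     ring R \<and> (\<forall>x \<in> carrier R. \<exists>y \<in> carrier R. x \<otimes>\<^bsub>R\<^esub> y \<otimes>\<^bsub>R\<^esub> x = x)"

text \<open>
  Undirected simple graphs are represented as symmetric, loop-free pair digraphs: an edge
  between u and v is the pair of opposite arcs (u, v) and (v, u).
\<close>

definition reg_graph :: "('a, 'm) ring_scheme \<Rightarrow> 'a pair_pre_digraph" where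
  "reg_graph R =
     \<lparr> pverts = carrier R - {\<zero>\<^bsub>R\<^esub>},
       parcs = {(a, b). a \<in> carrier R - {\<zero>\<^bsub>R\<^esub>} \<and> b \<in> carrier R - {\<zero>\<^bsub>R\<^esub>} \<and> a \<noteq> b \<and>
                  (a \<otimes>\<^bsub>R\<^esub> b \<otimes>\<^bsub>R\<^esub> a = a \<or> b \<otimes>\<^bsub>R\<^esub> a \<otimes>\<^bsub>R\<^esub> b = b)} \<rparr>"

definition path_graph :: "nat \<Rightarrow> nat pair_pre_digraph" where
  "path_graph n =
     (let E = {(i, i + 1) | i. 1 \<le> i \<and> i < n}
      in \<lparr> pverts = {1..n}, parcs = E \<union> E\<inverse> \<rparr>)"

definition cycle_graph :: "nat \<Rightarrow> nat pair_pre_digraph" where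
  "cycle_graph n =
     (let E = {(i, i + 1) | i. 1 \<le> i \<and> i < n} \<union> {(n, 1)}
      in \<lparr> pverts = {1..n}, parcs = E \<union> E\<inverse> \<rparr>)"

text \<open>The hub of the wheel is 0, which is not a vertex of the rim.\<close>

definition wheel_graph :: "nat \<Rightarrow> nat pair_pre_digraph" where
  "wheel_graph n =
     (let C = cycle_graph n; E = {0} \<times> pverts C
      in \<lparr> pverts = insert 0 (pverts C), parcs = parcs C \<union> E \<union> E\<inverse> \<rparr>)"

text \<open>
  A path graph is required to have at least one edge: the one-vertex graph is excluded.
  (It would otherwise be the graph of the field with two elements, whose only nonzero
  element is the identity.)
\<close>

definition is_path_graph :: "'a pair_pre_digraph \<Rightarrow> bool" where
  "is_path_graph G \<longleftrightarrow> (\<exists>n \<ge> 2. digraph_iso (with_proj G) (with_proj (path_graph n)))"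

definition is_cycle_graph :: "'a pair_pre_digraph \<Rightarrow> bool" where
  "is_cycle_graph G \<longleftrightarrow> (\<exists>n \<ge> 3. digraph_iso (with_proj G) (with_proj (cycle_graph n)))"

definition is_wheel_graph :: "'a pair_pre_digraph \<Rightarrow> bool" where
  "is_wheel_graph G \<longleftrightarrow> (\<exists>n \<ge> 3. digraph_iso (with_proj G) (with_proj (wheel_graph n)))"

end

theory Submission
  imports Defs
begin

text \<open>
  The neighbours of 1 are exactly the idempotents other than 0 and 1, and in a path, a cycle or
  a wheel no vertex is isolated, so there is an idempotent e besides 0 and 1.

  If all degrees are at most 2, then 0, 1, e and f = 1 - e are the only idempotents. For nonzero x
  in eR the element u = x + f is a unit adjacent to its inverse and to two other vertices,
  namely the products of the inverse with e and f. So u is its own inverse and the square of x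
  is e, whence eR consists of 0, e and -e, and likewise for f. As a path has a vertex of degree 1
  and a cycle has none, the concrete graphs of the resulting products separate the two cases.

  In a wheel 1 has at least 3 neighbours; since idempotents other than 0 and 1 come in pairs e,
  1 - e, it has at least 4. Hence 1 is the hub, everything is idempotent and the edges away from
  1 are the comparable pairs of the Boolean algebra. It contains a partition 1 = a + b + c, and a,
  being adjacent to 1, a + b and a + c, has no further neighbour, so it is an atom; likewise b and c.
\<close>

section \<open>Isomorphisms and degrees\<close>

no_notation vwalk_join (infixr "\<oplus>" 65)

definition nbrs :: "'a pair_pre_digraph \<Rightarrow> 'a \<Rightarrow> 'a set" where
  "nbrs G v = {u. (v, u) \<in> parcs G}"

text \<open>An arc of a pair digraph is its pair of ends, so a vertex map carries all the data of an
  isomorphism; no separate arc map is kept, unlike in \<open>digraph_iso\<close>.\<close>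

definition graph_iso :: "('a \<Rightarrow> 'b) \<Rightarrow> 'a pair_pre_digraph \<Rightarrow> 'b pair_pre_digraph \<Rightarrow> bool" where
  "graph_iso f G H \<longleftrightarrow> bij_betw f (pverts G) (pverts H) \<and>
     (\<forall>u \<in> pverts G. \<forall>v \<in> pverts G. (u, v) \<in> parcs G \<longleftrightarrow> (f u, f v) \<in> parcs H)"

text \<open>Both graphs have \<open>fst\<close> and \<open>snd\<close> as tail and head, which
  forces the arc map to be the vertex map applied to both ends.\<close>

lemma digraph_iso_imp_graph_iso:
  assumes "digraph_iso (with_proj G) (with_proj H)"
  shows "\<exists>f. graph_iso f G H"
proof -
  obtain \<phi> where \<phi>: "pre_digraph.digraph_isomorphism (with_proj G) \<phi>"
    and H: "with_proj H = app_iso \<phi> (with_proj G)"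
    using assms unfolding digraph_iso_def by auto
  define f where "f = iso_verts \<phi>"
  have wf: "wf_digraph (with_proj G)" and inj: "inj_on f (pverts G)"
    and ends: "\<And>a. a \<in> parcs G \<Longrightarrow> f (fst a) = iso_tail \<phi> (iso_arcs \<phi> a) \<and> f (snd a) = iso_head \<phi> (iso_arcs \<phi> a)"
    using \<phi> unfolding pre_digraph.digraph_isomorphism_def f_def by auto
  have V: "pverts H = f ` pverts G" and E: "parcs H = iso_arcs \<phi> ` parcs G"
    and th: "iso_tail \<phi> = fst" "iso_head \<phi> = snd"
    using arg_cong[OF H, of verts] arg_cong[OF H, of arcs] arg_cong[OF H, of tail]
      arg_cong[OF H, of head] by (auto simp: f_def)
  have arc: "iso_arcs \<phi> (u, v) = (f u, f v)" if "(u, v) \<in> parcs G" for u v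
    using ends[OF that] th by (simp add: prod_eq_iff)
  have "(u, v) \<in> parcs G \<longleftrightarrow> (f u, f v) \<in> parcs H" if uv: "u \<in> pverts G" "v \<in> pverts G" for u v
  proof
    assume "(u, v) \<in> parcs G"
    then show "(f u, f v) \<in> parcs H" using arc E by force
  next
    \<comment> \<open>An arc of \<open>H\<close> is only known to come from some arc of
      \<open>G\<close>; the ends of that arc are vertices, so injectivity identifies them with
      \<open>u\<close> and \<open>v\<close>.\<close>
    assume "(f u, f v) \<in> parcs H"
    then obtain x y where xy: "(x, y) \<in> parcs G" "iso_arcs \<phi> (x, y) = (f u, f v)"
      using E by auto
    then have "x \<in> pverts G" "y \<in> pverts G" "f x = f u" "f y = f v"
      using wf_digraph.tail_in_verts[OF wf, of "(x, y)"] wf_digraph.head_in_verts[OF wf, of "(x, y)"] arc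
      by auto
    then have "x = u" "y = v" using inj uv by (simp_all add: inj_on_eq_iff)
    then show "(u, v) \<in> parcs G" using xy(1) by simp
  qed
  then show ?thesis using inj V unfolding graph_iso_def bij_betw_def by blast
qed

text \<open>\<open>graph_iso\<close> speaks only of pairs of vertices, so arcs with other ends have
  to be excluded: in \<open>G\<close> for the arc map to be injective and land in \<open>H\<close>,
  in \<open>H\<close> for it to be onto.\<close>

lemma graph_iso_imp_digraph_iso:
  assumes f: "graph_iso f G H"
    and G: "parcs G \<subseteq> pverts G \<times> pverts G" and H: "parcs H \<subseteq> pverts H \<times> pverts H"
  shows "digraph_iso (with_proj G) (with_proj H)"
proof -
  define \<phi> where "\<phi> = \<lparr>iso_verts = f, iso_arcs = map_prod f f, iso_head = snd, iso_tail = fst\<rparr>"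
  have inj: "inj_on f (pverts G)" and V: "pverts H = f ` pverts G"
    using f unfolding graph_iso_def bij_betw_def by auto
  have wf: "wf_digraph (with_proj G)"
    using G by unfold_locales auto
  have "inj_on (map_prod f f) (parcs G)"
    using map_prod_inj_on[OF inj inj] G by (rule inj_on_subset)
  moreover have "parcs H = map_prod f f ` parcs G"
  proof
    show "parcs H \<subseteq> map_prod f f ` parcs G"
    proof (clarify)
      fix a b assume ab: "(a, b) \<in> parcs H"
      then obtain u v where "u \<in> pverts G" "v \<in> pverts G" "a = f u" "b = f v"
        using H V by blast
      moreover then have "(u, v) \<in> parcs G" using f ab unfolding graph_iso_def by auto
      ultimately show "(a, b) \<in> map_prod f f ` parcs G" by force
    qed
    show "map_prod f f ` parcs G \<subseteq> parcs H"
      using f G unfolding graph_iso_def by auto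
  qed
  ultimately have "pre_digraph.digraph_isomorphism (with_proj G) \<phi>" "with_proj H = app_iso \<phi> (with_proj G)"
    using inj V wf
    by (auto simp: pre_digraph.digraph_isomorphism_def app_iso_def \<phi>_def with_proj_def)
  then show ?thesis unfolding digraph_iso_def by blast
qed

lemma graph_iso_nbrs:
  assumes f: "graph_iso f G H" and v: "v \<in> pverts G"
    and G: "parcs G \<subseteq> pverts G \<times> pverts G" and H: "parcs H \<subseteq> pverts H \<times> pverts H"
  shows "nbrs H (f v) = f ` nbrs G v" and "card (nbrs H (f v)) = card (nbrs G v)"
proof -
  have inj: "inj_on f (pverts G)" and V: "pverts H = f ` pverts G"
    and E: "\<And>u. u \<in> pverts G \<Longrightarrow> (v, u) \<in> parcs G \<longleftrightarrow> (f v, f u) \<in> parcs H"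
    using f v unfolding graph_iso_def bij_betw_def by auto
  show *: "nbrs H (f v) = f ` nbrs G v"
    using E G H V by (auto simp: nbrs_def)
  have "nbrs G v \<subseteq> pverts G" using G by (auto simp: nbrs_def)
  then show "card (nbrs H (f v)) = card (nbrs G v)"
    unfolding * by (intro card_image inj_on_subset[OF inj])
qed

lemma graph_iso_comp:
  assumes "graph_iso f G H" "graph_iso g H K"
  shows "graph_iso (g \<circ> f) G K"
  using assms unfolding graph_iso_def by (auto intro: bij_betw_trans simp: bij_betwE)

text \<open>For \<open>n = 0\<close> the closing arc \<open>(n, 1)\<close> of the cycle would have
  an end outside the graph, hence the bound in two of the clauses.\<close>

lemma parcs_subset_pverts:
  "parcs (path_graph n) \<subseteq> pverts (path_graph n) \<times> pverts (path_graph n)"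
  "n \<ge> 1 \<Longrightarrow> parcs (cycle_graph n) \<subseteq> pverts (cycle_graph n) \<times> pverts (cycle_graph n)"
  "n \<ge> 1 \<Longrightarrow> parcs (wheel_graph n) \<subseteq> pverts (wheel_graph n) \<times> pverts (wheel_graph n)"
  "parcs (reg_graph R) \<subseteq> pverts (reg_graph R) \<times> pverts (reg_graph R)"
  by (auto simp: path_graph_def cycle_graph_def wheel_graph_def reg_graph_def Let_def)

section \<open>Degrees in paths, cycles and wheels\<close>

lemma card_nbrs_path_graph:
  assumes "n \<ge> 2" "v \<in> {1..n}"
  shows "card (nbrs (path_graph n) v) = (if v = 1 \<or> v = n then 1 else 2)"
proof -
  \<comment> \<open>As \<open>n\<close> is at least 2, the ends 1 and \<open>n\<close> are distinct
    and each has a neighbour.\<close>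
  have "nbrs (path_graph n) v = (if v = 1 then {2} else if v = n then {n - 1} else {v - 1, v + 1})"
    using assms by (auto simp: nbrs_def path_graph_def Let_def)
  then show ?thesis using assms by auto
qed

lemma nbrs_cycle_graph:
  assumes "n \<ge> 3" "v \<in> {1..n}"
  shows "nbrs (cycle_graph n) v =
    (if v = 1 then {2, n} else if v = n then {1, n - 1} else {v - 1, v + 1})"
  using assms by (auto simp: nbrs_def cycle_graph_def Let_def)

text \<open>For \<open>n\<close> at least 3 the two neighbours found above never coincide.\<close>

lemma card_nbrs_cycle_graph:
  assumes "n \<ge> 3" "v \<in> {1..n}"
  shows "card (nbrs (cycle_graph n) v) = 2"
  using assms by (auto simp: nbrs_cycle_graph card_insert_if)

lemma card_nbrs_wheel_graph:
  assumes "n \<ge> 3" "v \<in> {1..n}"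
  shows "card (nbrs (wheel_graph n) v) = 3"
proof -
  have "nbrs (wheel_graph n) v = insert 0 (nbrs (cycle_graph n) v)"
    using assms by (auto simp: nbrs_def wheel_graph_def cycle_graph_def Let_def)
  moreover have "0 \<notin> nbrs (cycle_graph n) v" "finite (nbrs (cycle_graph n) v)"
    using assms by (auto simp: nbrs_cycle_graph)
  ultimately show ?thesis using card_nbrs_cycle_graph[OF assms] by simp
qed

text \<open>Degrees survive isomorphism. The vertex of degree 1 is the one mapped to the end 1; it
  is what tells paths from cycles.\<close>

lemma path_graph_degrees:
  assumes "is_path_graph G" and G: "parcs G \<subseteq> pverts G \<times> pverts G"
  shows "\<And>v. v \<in> pverts G \<Longrightarrow> card (nbrs G v) \<in> {1, 2}"
    and "\<exists>v \<in> pverts G. card (nbrs G v) = 1"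
proof -
  obtain n f where n: "n \<ge> 2" and f: "graph_iso f G (path_graph n)"
    using assms(1) digraph_iso_imp_graph_iso unfolding is_path_graph_def by blast
  have V: "f ` pverts G = {1..n}"
    using f by (auto simp: graph_iso_def bij_betw_def path_graph_def Let_def)
  have deg: "card (nbrs G v) = (if f v = 1 \<or> f v = n then 1 else 2)" if "v \<in> pverts G" for v
  proof -
    have "f v \<in> {1..n}" using V that by blast
    then show ?thesis
      using graph_iso_nbrs(2)[OF f that G parcs_subset_pverts(1)] card_nbrs_path_graph[OF n] by simp
  qed
  then show "\<And>v. v \<in> pverts G \<Longrightarrow> card (nbrs G v) \<in> {1, 2}" by simp
  obtain v where "v \<in> pverts G" "f v = 1" using V n by (metis atLeastAtMost_iff imageE le_trans one_le_numeral order_refl)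
  then show "\<exists>v \<in> pverts G. card (nbrs G v) = 1" using deg by auto
qed

lemma cycle_graph_degrees:
  assumes "is_cycle_graph G" and G: "parcs G \<subseteq> pverts G \<times> pverts G"
  shows "\<And>v. v \<in> pverts G \<Longrightarrow> card (nbrs G v) = 2" and "pverts G \<noteq> {}"
proof -
  obtain n f where n: "n \<ge> 3" and f: "graph_iso f G (cycle_graph n)"
    using assms(1) digraph_iso_imp_graph_iso unfolding is_cycle_graph_def by blast
  have V: "f ` pverts G = {1..n}"
    using f by (auto simp: graph_iso_def bij_betw_def cycle_graph_def Let_def)
  show "card (nbrs G v) = 2" if "v \<in> pverts G" for v
  proof -
    have "f v \<in> {1..n}" using V that by blast
    then show ?thesis
      using graph_iso_nbrs(2)[OF f that G parcs_subset_pverts(2)] card_nbrs_cycle_graph[OF n] n by simp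
  qed
  show "pverts G \<noteq> {}" using V n by auto
qed

text \<open>\<open>h\<close> is the vertex mapped to the hub 0. It is only asserted to exist: for
  \<open>n = 3\<close> the rim vertices have the hub's degree too.\<close>

lemma wheel_graph_degrees:
  assumes "is_wheel_graph G" and G: "parcs G \<subseteq> pverts G \<times> pverts G"
  shows "\<exists>h \<in> pverts G. pverts G \<subseteq> insert h (nbrs G h) \<and> card (nbrs G h) \<ge> 3 \<and>
           (\<forall>v \<in> pverts G - {h}. card (nbrs G v) = 3)"
proof -
  obtain n f where n: "n \<ge> 3" and f: "graph_iso f G (wheel_graph n)"
    using assms(1) digraph_iso_imp_graph_iso unfolding is_wheel_graph_def by blast
  have inj: "inj_on f (pverts G)" and V: "f ` pverts G = {0..n}"
    using f by (auto simp: graph_iso_def bij_betw_def wheel_graph_def cycle_graph_def Let_def)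
  obtain h where h: "h \<in> pverts G" "f h = 0" using V by (metis atLeastAtMost_iff imageE le0)
  have nb0: "nbrs (wheel_graph n) 0 = {1..n}"
    using n by (auto simp: nbrs_def wheel_graph_def cycle_graph_def Let_def)
  have "card (nbrs G h) = n"
    using graph_iso_nbrs(2)[OF f h(1) G parcs_subset_pverts(3)] nb0 h n by auto
  moreover have "v \<in> insert h (nbrs G h)" if v: "v \<in> pverts G" for v
  proof (cases "f v = 0")
    case True
    then have "v = h" using h v inj by (metis inj_on_eq_iff)
    then show ?thesis by simp
  next
    case False
    then have "f v \<in> nbrs (wheel_graph n) (f h)" using V v nb0 h by auto
    then show ?thesis using f v h unfolding graph_iso_def nbrs_def by auto
  qed
  moreover have "card (nbrs G v) = 3" if v: "v \<in> pverts G - {h}" for v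
  proof -
    have "f v \<in> {1..n}" using V v h inj by (metis DiffE One_nat_def Suc_leI atLeastAtMost_iff bot_nat_0.not_eq_extremum imageI inj_on_eq_iff insertI1)
    then show ?thesis
      using graph_iso_nbrs(2)[OF f _ G parcs_subset_pverts(3), of v] card_nbrs_wheel_graph[OF n, of "f v"] v n by auto
  qed
  ultimately show ?thesis using h n by auto
qed

lemma not_path_and_cycle:
  assumes "is_path_graph G" "is_cycle_graph G" "parcs G \<subseteq> pverts G \<times> pverts G"
  shows False
  using path_graph_degrees(2)[of G] cycle_graph_degrees(1)[of G] assms by force

section \<open>The graphs of the four products\<close>

text \<open>Adjacency is an equation between products, which a ring isomorphism preserves and, being
  injective, reflects.\<close>

lemma graph_iso_reg_graph:
  assumes h: "h \<in> ring_iso R S" and R: "ring R" and S: "ring S"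
  shows "graph_iso h (reg_graph R) (reg_graph S)"
proof -
  note hE = ring_iso_memE[OF h]
  have h0: "h \<zero>\<^bsub>R\<^esub> = \<zero>\<^bsub>S\<^esub>"
    using h R S ring_hom_zero unfolding ring_iso_def by blast
  have inj: "inj_on h (carrier R)" and im: "h ` carrier R = carrier S"
    using hE(5) by (auto simp: bij_betw_def)
  have z: "\<zero>\<^bsub>R\<^esub> \<in> carrier R" using R by (simp add: ring.ring_simprules)
  have "bij_betw h (carrier R - {\<zero>\<^bsub>R\<^esub>}) (carrier S - {\<zero>\<^bsub>S\<^esub>})"
    using inj im h0 z inj_on_image_set_diff[OF inj, of "carrier R" "{\<zero>\<^bsub>R\<^esub>}"]
    by (auto simp: bij_betw_def intro: inj_on_subset)
  moreover have tri: "a \<otimes>\<^bsub>R\<^esub> b \<otimes>\<^bsub>R\<^esub> a = a \<longleftrightarrow> h a \<otimes>\<^bsub>S\<^esub> h b \<otimes>\<^bsub>S\<^esub> h a = h a"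
    if "a \<in> carrier R" "b \<in> carrier R" for a b
  proof -
    have c: "a \<otimes>\<^bsub>R\<^esub> b \<in> carrier R" "a \<otimes>\<^bsub>R\<^esub> b \<otimes>\<^bsub>R\<^esub> a \<in> carrier R"
      using that R by (simp_all add: ring.ring_simprules)
    then have "h a \<otimes>\<^bsub>S\<^esub> h b \<otimes>\<^bsub>S\<^esub> h a = h (a \<otimes>\<^bsub>R\<^esub> b \<otimes>\<^bsub>R\<^esub> a)"
      using that by (simp add: hE(2))
    then show ?thesis using inj c that by (simp add: inj_on_eq_iff)
  qed
  moreover have "h a = h b \<longleftrightarrow> a = b" if "a \<in> carrier R" "b \<in> carrier R" for a b
    using inj that by (simp add: inj_on_eq_iff)
  moreover have "h a \<in> carrier S" if "a \<in> carrier R" for a using im that by auto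
  moreover have "h a = \<zero>\<^bsub>S\<^esub> \<longleftrightarrow> a = \<zero>\<^bsub>R\<^esub>" if "a \<in> carrier R" for a
    using inj that h0 z by (metis inj_on_eq_iff)
  ultimately show ?thesis
    unfolding graph_iso_def reg_graph_def by auto
qed

lemma ring_residue_ring:
  assumes "m > 1"
  shows "ring (residue_ring m)"
  using residues.cring[of m] assms by (simp add: residues_def cring_def)

lemma RDirProd_simps:
  "carrier (RDirProd R S) = carrier R \<times> carrier S"
  "\<zero>\<^bsub>RDirProd R S\<^esub> = (\<zero>\<^bsub>R\<^esub>, \<zero>\<^bsub>S\<^esub>)"
  "\<one>\<^bsub>RDirProd R S\<^esub> = (\<one>\<^bsub>R\<^esub>, \<one>\<^bsub>S\<^esub>)"
  "(a, b) \<otimes>\<^bsub>RDirProd R S\<^esub> (c, d) = (a \<otimes>\<^bsub>R\<^esub> c, b \<otimes>\<^bsub>S\<^esub> d)"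
  "(a, b) \<oplus>\<^bsub>RDirProd R S\<^esub> (c, d) = (a \<oplus>\<^bsub>R\<^esub> c, b \<oplus>\<^bsub>S\<^esub> d)"
  by (auto simp: RDirProd_def DirProd_def monoid.defs)

lemma residue_ring_simps:
  "carrier (residue_ring m) = {0..m - 1}" "\<zero>\<^bsub>residue_ring m\<^esub> = 0" "\<one>\<^bsub>residue_ring m\<^esub> = 1"
  "a \<otimes>\<^bsub>residue_ring m\<^esub> b = (a * b) mod m" "a \<oplus>\<^bsub>residue_ring m\<^esub> b = (a + b) mod m"
  by (auto simp: residue_ring_def)

lemma in_parcs_path_graph:
  "(i, j) \<in> parcs (path_graph n) \<longleftrightarrow>
     1 \<le> i \<and> 1 \<le> j \<and> i \<le> n \<and> j \<le> n \<and> (j = i + 1 \<or> i = j + 1)"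
  by (auto simp: path_graph_def Let_def)

lemma in_parcs_cycle_graph:
  "(i, j) \<in> parcs (cycle_graph n) \<longleftrightarrow>
     1 \<le> i \<and> 1 \<le> j \<and> i \<le> n \<and> j \<le> n \<and> (j = i + 1 \<or> i = j + 1) \<or>
     i = n \<and> j = 1 \<or> i = 1 \<and> j = n"
  by (auto simp: cycle_graph_def Let_def)

lemma in_parcs_wheel_graph:
  "(i, j) \<in> parcs (wheel_graph n) \<longleftrightarrow>
     (i, j) \<in> parcs (cycle_graph n) \<or> i = 0 \<and> 1 \<le> j \<and> j \<le> n \<or> j = 0 \<and> 1 \<le> i \<and> i \<le> n"
  by (auto simp: wheel_graph_def cycle_graph_def Let_def)

lemma carrier_residue_ring_2: "carrier (residue_ring 2) = {0, 1}"
  and carrier_residue_ring_3: "carrier (residue_ring 3) = {0, 1, 2}"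
  by (auto simp: residue_ring_def)

text \<open>The interval form of the carrier is left out, so that carriers unfold to explicit finite
  sets and the graphs below can be evaluated.\<close>

lemmas product_simps = reg_graph_def RDirProd_simps carrier_residue_ring_2 carrier_residue_ring_3
  residue_ring_simps(2-)

text \<open>In the fields with 2 and 3 elements every nonzero element is its own inverse. So in
  their products two distinct vertices are adjacent exactly when one arises from the other by
  replacing coordinates by 0.\<close>

lemma graph_iso_F2_F2:
  "\<exists>f. graph_iso f (reg_graph (RDirProd (residue_ring 2) (residue_ring 2))) (path_graph 3)"
proof -
  let ?S = "RDirProd (residue_ring 2) (residue_ring 2)"
  \<comment> \<open>Numbering along the path, with the identity in the middle.\<close>
  define f :: "int \<times> int \<Rightarrow> nat"
    where "f p = (if p = (1, 0) then 1 else if p = (1, 1) then 2 else 3)" for p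
  have V: "pverts (reg_graph ?S) = {(1, 0), (1, 1), (0, 1)}"
    by (auto simp: product_simps)
  have W: "pverts (path_graph 3) = {1, 2, 3}"
    by (auto simp: path_graph_def Let_def)
  show ?thesis
    by (rule exI[of _ f], unfold graph_iso_def V W)
      (simp add: bij_betw_def f_def in_parcs_path_graph product_simps insert_commute)
qed

lemma graph_iso_F2_F3:
  "\<exists>f. graph_iso f (reg_graph (RDirProd (residue_ring 2) (residue_ring 3))) (path_graph 5)"
proof -
  let ?S = "RDirProd (residue_ring 2) (residue_ring 3)"
  \<comment> \<open>Here \<open>(1, 0)\<close> is the middle vertex; the arms on its two sides are
    the two signs of the second coordinate.\<close>
  define f :: "int \<times> int \<Rightarrow> nat"
    where "f p = (if p = (0, 1) then 1 else if p = (1, 1) then 2 else if p = (1, 0) then 3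
      else if p = (1, 2) then 4 else 5)" for p
  have V: "pverts (reg_graph ?S) = {(0, 1), (1, 1), (1, 0), (1, 2), (0, 2)}"
    by (auto simp: product_simps)
  have W: "pverts (path_graph 5) = {1, 2, 3, 4, 5}"
    by (auto simp: path_graph_def Let_def)
  show ?thesis
    by (rule exI[of _ f], unfold graph_iso_def V W)
      (simp add: bij_betw_def f_def in_parcs_path_graph product_simps insert_commute)
qed

lemma graph_iso_F3_F3:
  "\<exists>f. graph_iso f (reg_graph (RDirProd (residue_ring 3) (residue_ring 3))) (cycle_graph 8)"
proof -
  let ?S = "RDirProd (residue_ring 3) (residue_ring 3)"
  \<comment> \<open>Once around the cycle: units alternate with elements having a zero coordinate,
    and each such element lies between the two units extending it.\<close>
  define f :: "int \<times> int \<Rightarrow> nat"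
    where "f p = (if p = (1, 1) then 1 else if p = (1, 0) then 2 else if p = (1, 2) then 3
      else if p = (0, 2) then 4 else if p = (2, 2) then 5 else if p = (2, 0) then 6
      else if p = (2, 1) then 7 else 8)" for p
  have V: "pverts (reg_graph ?S) =
      {(1, 1), (1, 0), (1, 2), (0, 2), (2, 2), (2, 0), (2, 1), (0, 1)}"
    by (auto simp: product_simps)
  have W: "pverts (cycle_graph 8) = {1, 2, 3, 4, 5, 6, 7, 8}"
    by (auto simp: cycle_graph_def Let_def)
  show ?thesis
    by (rule exI[of _ f], unfold graph_iso_def V W)
      (simp add: bij_betw_def f_def in_parcs_cycle_graph product_simps insert_commute)
qed

lemma graph_iso_F2_F2_F2:
  "\<exists>f. graph_iso f (reg_graph (RDirProd (residue_ring 2)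
     (RDirProd (residue_ring 2) (residue_ring 2)))) (wheel_graph 6)"
proof -
  let ?S = "RDirProd (residue_ring 2) (RDirProd (residue_ring 2) (residue_ring 2))"
  \<comment> \<open>The identity is the hub; along the rim the atoms of the Boolean algebra
    alternate with the coatoms above them.\<close>
  define f :: "int \<times> int \<times> int \<Rightarrow> nat"
    where "f p = (if p = (1, 1, 1) then 0 else if p = (1, 0, 0) then 1 else if p = (1, 1, 0) then 2
      else if p = (0, 1, 0) then 3 else if p = (0, 1, 1) then 4 else if p = (0, 0, 1) then 5
      else 6)" for p
  have V: "pverts (reg_graph ?S) =
      {(1, 1, 1), (1, 0, 0), (1, 1, 0), (0, 1, 0), (0, 1, 1), (0, 0, 1), (1, 0, 1)}"
    by (auto simp: product_simps)
  have W: "pverts (wheel_graph 6) = {0, 1, 2, 3, 4, 5, 6}"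
    by (auto simp: wheel_graph_def cycle_graph_def Let_def)
  show ?thesis
    by (rule exI[of _ f], unfold graph_iso_def V W)
      (simp add: bij_betw_def f_def in_parcs_wheel_graph in_parcs_cycle_graph product_simps insert_commute)
qed

lemma digraph_iso_reg_graph:
  assumes "R \<simeq> S" "ring R" "ring S" "\<exists>f. graph_iso f (reg_graph S) H"
    and "parcs H \<subseteq> pverts H \<times> pverts H"
  shows "digraph_iso (with_proj (reg_graph R)) (with_proj H)"
proof -
  obtain g f where "g \<in> ring_iso R S" "graph_iso f (reg_graph S) H"
    using assms by (auto simp: is_ring_iso_def)
  then have "graph_iso (f \<circ> g) (reg_graph R) H"
    using graph_iso_comp graph_iso_reg_graph assms by blast
  then show ?thesis by (rule graph_iso_imp_digraph_iso[OF _ parcs_subset_pverts(4) assms(5)])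
qed

text \<open>The sizes 3, 5 and 8 below are the numbers of nonzero elements; 6 is that number without
  the hub.\<close>

lemma reg_graph_of_products:
  assumes "ring R"
  shows "R \<simeq> RDirProd (residue_ring 2) (residue_ring 2) \<Longrightarrow> is_path_graph (reg_graph R)"
    and "R \<simeq> RDirProd (residue_ring 2) (residue_ring 3) \<Longrightarrow> is_path_graph (reg_graph R)"
    and "R \<simeq> RDirProd (residue_ring 3) (residue_ring 3) \<Longrightarrow> is_cycle_graph (reg_graph R)"
    and "R \<simeq> RDirProd (residue_ring 2) (RDirProd (residue_ring 2) (residue_ring 2)) \<Longrightarrow>
      is_wheel_graph (reg_graph R)"
proof -
  have r: "ring (residue_ring 2)" "ring (residue_ring 3)" by (simp_all add: ring_residue_ring)
  note rings = RDirProd_ring[OF r(1) r(1)] RDirProd_ring[OF r] RDirProd_ring[OF r(2) r(2)]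
    RDirProd_ring[OF r(1) RDirProd_ring[OF r(1) r(1)]]
  show "is_path_graph (reg_graph R)" if "R \<simeq> RDirProd (residue_ring 2) (residue_ring 2)"
    unfolding is_path_graph_def
    using digraph_iso_reg_graph[OF that assms rings(1) graph_iso_F2_F2 parcs_subset_pverts(1)]
    by (intro exI[of _ 3]) simp
  show "is_path_graph (reg_graph R)" if "R \<simeq> RDirProd (residue_ring 2) (residue_ring 3)"
    unfolding is_path_graph_def
    using digraph_iso_reg_graph[OF that assms rings(2) graph_iso_F2_F3 parcs_subset_pverts(1)]
    by (intro exI[of _ 5]) simp
  show "is_cycle_graph (reg_graph R)" if "R \<simeq> RDirProd (residue_ring 3) (residue_ring 3)"
    unfolding is_cycle_graph_def
    using digraph_iso_reg_graph[OF that assms rings(3) graph_iso_F3_F3 parcs_subset_pverts(2)]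
    by (intro exI[of _ 8]) simp
  show "is_wheel_graph (reg_graph R)"
    if "R \<simeq> RDirProd (residue_ring 2) (RDirProd (residue_ring 2) (residue_ring 2))"
    unfolding is_wheel_graph_def
    using digraph_iso_reg_graph[OF that assms rings(4) graph_iso_F2_F2_F2 parcs_subset_pverts(3)]
    by (intro exI[of _ 6]) simp
qed

section \<open>Corners of a commutative ring\<close>

text \<open>A homomorphism that identifies the corner ring eR with S, stated on R itself.\<close>

definition corner_hom :: "('a, 'm) ring_scheme \<Rightarrow> 'a \<Rightarrow> ('b, 'n) ring_scheme \<Rightarrow> ('a \<Rightarrow> 'b) \<Rightarrow> bool" where
  "corner_hom R e S h \<longleftrightarrow> h \<in> ring_hom R S \<and> h ` carrier R = carrier S \<and>
     (\<forall>x \<in> carrier R. \<forall>y \<in> carrier R. h x = h y \<longleftrightarrow> x \<otimes>\<^bsub>R\<^esub> e = y \<otimes>\<^bsub>R\<^esub> e)"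

context cring
begin

text \<open>Multiplication by the idempotent \<open>e\<close> respects sums and products, so it
  suffices to compare the tables of 0 and \<open>e\<close> with those of 0 and 1.\<close>

lemma corner_hom_F2:
  assumes e: "e \<in> carrier R" "e \<otimes> e = e" "e \<noteq> \<zero>" "e \<oplus> e = \<zero>"
    and x: "\<And>x. x \<in> carrier R \<Longrightarrow> x \<otimes> e \<in> {\<zero>, e}"
  shows "\<exists>h. corner_hom R e (residue_ring 2) h"
proof -
  define h :: "'a \<Rightarrow> int" where "h x = (if x \<otimes> e = \<zero> then 0 else 1)" for x
  have m: "(x \<otimes> y) \<otimes> e = (x \<otimes> e) \<otimes> (y \<otimes> e)" and a: "(x \<oplus> y) \<otimes> e = x \<otimes> e \<oplus> y \<otimes> e"
    if "x \<in> carrier R" "y \<in> carrier R" for x y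
    using e that by (simp_all add: l_distr) (metis m_assoc m_closed m_lcomm)
  have "h \<in> ring_hom R (residue_ring 2)"
  proof (rule ring_hom_memI)
    show "h x \<in> carrier (residue_ring 2)" for x by (simp add: h_def residue_ring_simps)
    show "h \<one> = \<one>\<^bsub>residue_ring 2\<^esub>"
      using e by (simp add: h_def residue_ring_simps)
    fix x y assume xy: "x \<in> carrier R" "y \<in> carrier R"
    show "h (x \<otimes> y) = h x \<otimes>\<^bsub>residue_ring 2\<^esub> h y"
      using x[OF xy(1)] x[OF xy(2)] e m[OF xy] by (auto simp: h_def residue_ring_simps)
    show "h (x \<oplus> y) = h x \<oplus>\<^bsub>residue_ring 2\<^esub> h y"
      using x[OF xy(1)] x[OF xy(2)] e a[OF xy] by (auto simp: h_def residue_ring_simps)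
  qed
  moreover have "h ` carrier R = carrier (residue_ring 2)"
  proof -
    have "h \<zero> = 0" "h \<one> = 1" using e by (auto simp: h_def)
    then have "{0, 1} \<subseteq> h ` carrier R" by (metis bot.extremum image_eqI insert_subset one_closed zero_closed)
    then show ?thesis by (auto simp: carrier_residue_ring_2 h_def)
  qed
  moreover have "h x = h y \<longleftrightarrow> x \<otimes> e = y \<otimes> e" if "x \<in> carrier R" "y \<in> carrier R" for x y
    using x[OF that(1)] x[OF that(2)] e by (auto simp: h_def)
  ultimately show ?thesis unfolding corner_hom_def by blast
qed

lemma corner_hom_F3:
  assumes e: "e \<in> carrier R" "e \<otimes> e = e" "e \<noteq> \<zero>" "e \<oplus> e \<noteq> \<zero>"
    and x: "\<And>x. x \<in> carrier R \<Longrightarrow> x \<otimes> e \<in> {\<zero>, e, \<ominus> e}"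
  shows "\<exists>h. corner_hom R e (residue_ring 3) h"
proof -
  \<comment> \<open>The remaining value 2 stands for \<open>\<ominus> e\<close>.\<close>
  define h :: "'a \<Rightarrow> int" where "h x = (if x \<otimes> e = \<zero> then 0 else if x \<otimes> e = e then 1 else 2)" for x
  have m: "(x \<otimes> y) \<otimes> e = (x \<otimes> e) \<otimes> (y \<otimes> e)" and a: "(x \<oplus> y) \<otimes> e = x \<otimes> e \<oplus> y \<otimes> e"
    if "x \<in> carrier R" "y \<in> carrier R" for x y
    using e that by (simp_all add: l_distr) (metis m_assoc m_closed m_lcomm)
  have ne: "\<ominus> e \<noteq> \<zero>" "\<ominus> e \<noteq> e"
    using e by (metis a_inv_closed minus_minus minus_zero, metis r_neg)
  \<comment> \<open>The double of \<open>e\<close> lies in the corner; it is not 0 by assumption and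
    not \<open>e\<close> by cancellation, so it is \<open>\<ominus> e\<close>. This is
    characteristic 3 and fills the addition table.\<close>
  have "e \<oplus> e = (e \<oplus> e) \<otimes> e" using e by (simp add: l_distr)
  then have "e \<oplus> e \<in> {\<zero>, e, \<ominus> e}" using x[of "e \<oplus> e"] e by simp
  moreover have "e \<oplus> e \<noteq> e" using e by (metis r_zero add.l_cancel zero_closed)
  ultimately have ee: "e \<oplus> e = \<ominus> e" using e by auto
  then have nn: "\<ominus> e \<oplus> \<ominus> e = e" using e by (metis minus_add minus_minus)
  have mm: "\<ominus> e \<otimes> e = \<ominus> e" "e \<otimes> \<ominus> e = \<ominus> e" "\<ominus> e \<otimes> \<ominus> e = e"
    using e by (simp_all add: l_minus r_minus)
  have z: "\<ominus> e \<oplus> e = \<zero>" "e \<oplus> \<ominus> e = \<zero>" using e by (simp_all add: l_neg r_neg)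
  note facts = e ne ne[symmetric] ee nn mm z
  have "h \<in> ring_hom R (residue_ring 3)"
  proof (rule ring_hom_memI)
    show "h x \<in> carrier (residue_ring 3)" for x by (simp add: h_def residue_ring_simps)
    show "h \<one> = \<one>\<^bsub>residue_ring 3\<^esub>"
      using e by (simp add: h_def residue_ring_simps)
    fix x y assume xy: "x \<in> carrier R" "y \<in> carrier R"
    show "h (x \<otimes> y) = h x \<otimes>\<^bsub>residue_ring 3\<^esub> h y"
      using x[OF xy(1)] x[OF xy(2)] facts m[OF xy] by (auto simp: h_def residue_ring_simps)
    show "h (x \<oplus> y) = h x \<oplus>\<^bsub>residue_ring 3\<^esub> h y"
      using x[OF xy(1)] x[OF xy(2)] facts a[OF xy] by (auto simp: h_def residue_ring_simps)
  qed
  moreover have "h ` carrier R = carrier (residue_ring 3)"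
  proof -
    have "h \<zero> = 0" "h \<one> = 1" "h (\<ominus> e) = 2" using facts by (auto simp: h_def)
    then have "{0, 1, 2} \<subseteq> h ` carrier R"
      using e by (metis bot.extremum image_eqI insert_subset one_closed zero_closed a_inv_closed)
    then show ?thesis by (auto simp: carrier_residue_ring_3 h_def)
  qed
  moreover have "h x = h y \<longleftrightarrow> x \<otimes> e = y \<otimes> e" if "x \<in> carrier R" "y \<in> carrier R" for x y
    using x[OF that(1)] x[OF that(2)] facts by (auto simp: h_def)
  ultimately show ?thesis unfolding corner_hom_def by blast
qed

text \<open>By orthogonality the corner of \<open>e \<oplus> f\<close> is the direct product of the
  corners of \<open>e\<close> and \<open>f\<close>; iterating this assembles R from small
  corners.\<close>

lemma corner_hom_prod:
  assumes g: "corner_hom R e S g" and h: "corner_hom R f T h"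
    and e: "e \<in> carrier R" "e \<otimes> e = e" and f: "f \<in> carrier R" "f \<otimes> f = f" and ef: "e \<otimes> f = \<zero>"
  shows "corner_hom R (e \<oplus> f) (RDirProd S T) (\<lambda>x. (g x, h x))"
proof -
  have fe: "f \<otimes> e = \<zero>" using e f ef by (simp add: m_comm)
  have gh: "g \<in> ring_hom R S" "h \<in> ring_hom R T"
    and im: "g ` carrier R = carrier S" "h ` carrier R = carrier T"
    and geq: "\<And>x y. x \<in> carrier R \<Longrightarrow> y \<in> carrier R \<Longrightarrow> g x = g y \<longleftrightarrow> x \<otimes> e = y \<otimes> e"
    and heq: "\<And>x y. x \<in> carrier R \<Longrightarrow> y \<in> carrier R \<Longrightarrow> h x = h y \<longleftrightarrow> x \<otimes> f = y \<otimes> f"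
    using g h unfolding corner_hom_def by blast+
  have "(\<lambda>x. (g x, h x)) \<in> ring_hom R (RDirProd S T)"
    using ring_hom_memE[OF gh(1)] ring_hom_memE[OF gh(2)]
    by (intro ring_hom_memI) (auto simp: RDirProd_simps)
  moreover have "carrier S \<times> carrier T \<subseteq> (\<lambda>x. (g x, h x)) ` carrier R"
  proof clarify
    fix s t assume "s \<in> carrier S" "t \<in> carrier T"
    then obtain x y where xy: "x \<in> carrier R" "y \<in> carrier R" "s = g x" "t = h y"
      using im by (metis imageE)
    \<comment> \<open>Multiplying \<open>z\<close> by \<open>e\<close> or by \<open>f\<close>
      isolates one summand, so the two coordinates can be prescribed independently.\<close>
    define z where "z = x \<otimes> e \<oplus> y \<otimes> f"
    have "z \<in> carrier R" "z \<otimes> e = x \<otimes> e" "z \<otimes> f = y \<otimes> f"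
      using xy e f ef fe by (simp_all add: z_def l_distr m_assoc)
    then have "z \<in> carrier R" "g z = s" "h z = t"
      using xy geq heq by simp_all
    then show "(s, t) \<in> (\<lambda>x. (g x, h x)) ` carrier R" by force
  qed
  moreover have "x \<otimes> e = y \<otimes> e \<and> x \<otimes> f = y \<otimes> f \<longleftrightarrow> x \<otimes> (e \<oplus> f) = y \<otimes> (e \<oplus> f)"
    if "x \<in> carrier R" "y \<in> carrier R" for x y
  proof
    assume "x \<otimes> (e \<oplus> f) = y \<otimes> (e \<oplus> f)"
    then have "x \<otimes> (e \<oplus> f) \<otimes> e = y \<otimes> (e \<oplus> f) \<otimes> e" "x \<otimes> (e \<oplus> f) \<otimes> f = y \<otimes> (e \<oplus> f) \<otimes> f"
      by simp_all
    then show "x \<otimes> e = y \<otimes> e \<and> x \<otimes> f = y \<otimes> f"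
      using that e f ef fe by (simp add: m_assoc l_distr)
  qed (use that e f in \<open>simp add: r_distr\<close>)
  ultimately show ?thesis
    using ring_hom_memE(1)[OF gh(1)] ring_hom_memE(1)[OF gh(2)] geq heq
    unfolding corner_hom_def by (auto simp: RDirProd_simps)
qed

text \<open>The corner of 1 is the whole ring, so the last condition of \<open>corner_hom\<close>
  becomes injectivity.\<close>

lemma corner_hom_one:
  assumes "corner_hom R \<one> S h"
  shows "R \<simeq> S"
proof -
  have "h \<in> ring_iso R S"
    using assms unfolding corner_hom_def ring_iso_def bij_betw_def inj_on_def by auto
  then show ?thesis by (auto simp: is_ring_iso_def)
qed

section \<open>Neighbours of 1 and complementary idempotents\<close>

lemma nbrs_reg_graph:
  "a \<in> carrier R \<Longrightarrow> nbrs (reg_graph R) a =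
     {b \<in> carrier R. a \<noteq> \<zero> \<and> b \<noteq> \<zero> \<and> a \<noteq> b \<and> (a \<otimes> b \<otimes> a = a \<or> b \<otimes> a \<otimes> b = b)}"
  by (auto simp: nbrs_def reg_graph_def)

text \<open>With \<open>a = \<one>\<close>, one of the two adjacency equations forces
  \<open>b = \<one>\<close>, which is excluded, and the other is idempotence. In the zero ring both
  sides are empty.\<close>

lemma nbrs_one:
  "nbrs (reg_graph R) \<one> = {e \<in> carrier R. e \<otimes> e = e \<and> e \<noteq> \<zero> \<and> e \<noteq> \<one>}"
  by (auto simp: nbrs_reg_graph dest: one_zeroD)

lemma finite_nbrs: "finite (carrier R) \<Longrightarrow> finite (nbrs (reg_graph R) a)"
  by (rule finite_subset[of _ "carrier R"]) (auto simp: nbrs_def reg_graph_def)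

lemma complement_idempotent:
  assumes e: "e \<in> carrier R" "e \<otimes> e = e"
  shows "\<one> \<ominus> e \<in> carrier R" "(\<one> \<ominus> e) \<otimes> (\<one> \<ominus> e) = \<one> \<ominus> e" "e \<otimes> (\<one> \<ominus> e) = \<zero>"
    "e \<oplus> (\<one> \<ominus> e) = \<one>" "\<one> \<ominus> e = \<zero> \<longleftrightarrow> e = \<one>" "\<one> \<ominus> (\<one> \<ominus> e) = e"
proof -
  show c: "\<one> \<ominus> e \<in> carrier R" using e by simp
  show z: "e \<otimes> (\<one> \<ominus> e) = \<zero>" using e by (simp add: minus_eq r_distr r_minus r_neg)
  \<comment> \<open>Expanding only the first factor leaves a multiple of
    \<open>e \<otimes> (\<one> \<ominus> e)\<close>, already known to vanish.\<close>
  have "(\<one> \<ominus> e) \<otimes> (\<one> \<ominus> e) = (\<one> \<ominus> e) \<ominus> e \<otimes> (\<one> \<ominus> e)"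
    using e c by (simp add: minus_eq l_distr l_minus)
  then show "(\<one> \<ominus> e) \<otimes> (\<one> \<ominus> e) = \<one> \<ominus> e" using z c by (simp add: minus_eq)
  show "e \<oplus> (\<one> \<ominus> e) = \<one>" using e by (simp add: minus_eq a_lcomm[of e \<one>] r_neg)
  show "\<one> \<ominus> e = \<zero> \<longleftrightarrow> e = \<one>" using e by auto
  show "\<one> \<ominus> (\<one> \<ominus> e) = e" using e by (simp add: minus_eq minus_add a_assoc[symmetric] r_neg)
qed

section \<open>Rings whose graph has all degrees at most 2\<close>

lemma corner_involution:
  assumes fin: "finite (carrier R)" and vnr: "von_neumann_regular R"
    and deg: "\<And>v. v \<in> carrier R \<Longrightarrow> v \<noteq> \<zero> \<Longrightarrow> card (nbrs (reg_graph R) v) \<le> 2"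
    and e: "e \<in> carrier R" "e \<otimes> e = e" and f: "f \<in> carrier R" "f \<otimes> f = f" "f \<noteq> \<zero>"
    and ef: "e \<otimes> f = \<zero>" "e \<oplus> f = \<one>"
    and idem: "\<And>p. p \<in> carrier R \<Longrightarrow> p \<otimes> p = p \<Longrightarrow> p \<in> {\<zero>, \<one>, e, f}"
    and x: "x \<in> carrier R" "x \<otimes> e = x" "x \<noteq> \<zero>"
  shows "x \<otimes> x = e"
proof -
  obtain y where y: "y \<in> carrier R" "x \<otimes> y \<otimes> x = x"
    using vnr x unfolding von_neumann_regular_def by blast
  have fe: "f \<otimes> e = \<zero>" using e f ef by (simp add: m_comm)
  \<comment> \<open>By regularity \<open>p\<close> is an idempotent of the corner, and it is nonzero
    because \<open>p \<otimes> x = x\<close>. The list of idempotents leaves only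
    \<open>e\<close>.\<close>
  define p where "p = x \<otimes> y"
  have p: "p \<in> carrier R" "p \<otimes> p = p" "p \<otimes> x = x"
    using x y by (simp_all add: p_def) (metis m_assoc m_closed)
  have pe: "p \<otimes> e = p" using x y e by (metis m_assoc m_comm p_def)
  have "p \<noteq> \<zero>" using p x by auto
  moreover have "p \<noteq> f" using pe fe \<open>p \<noteq> \<zero>\<close> by auto
  moreover have "p = \<one> \<Longrightarrow> p = e" using pe e by auto
  ultimately have pe': "p = e" using idem[OF p(1,2)] by auto
  \<comment> \<open>\<open>y\<close> cut down to the corner: the inverse of \<open>x\<close> with
    respect to the identity \<open>e\<close>.\<close>
  define z where "z = y \<otimes> e"
  have z: "z \<in> carrier R" "z \<otimes> e = z" using y e by (simp_all add: z_def m_assoc)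
  have xz: "x \<otimes> z = e" using pe' x y e by (simp add: z_def p_def m_assoc[symmetric])
  have zx: "z \<otimes> x = e" using xz x z by (simp add: m_comm)
  have xf: "x \<otimes> f = \<zero>" "f \<otimes> x = \<zero>" and zf: "z \<otimes> f = \<zero>" "f \<otimes> z = \<zero>"
    using x z e f ef by (metis m_assoc m_comm r_null)+
  have ez: "e \<otimes> z = z" "e \<otimes> x = x" using z x e by (simp_all add: m_comm)
  have e0: "e \<noteq> \<zero>" using x by auto
  have z0: "z \<noteq> \<zero>" using xz x e0 by auto
  \<comment> \<open>Adding \<open>f\<close> completes \<open>x\<close> and \<open>z\<close> to
    mutually inverse units of R.\<close>
  define u where "u = x \<oplus> f"
  define w where "w = z \<oplus> f"
  note facts = x z e f ef fe xz zx xf zf ez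
  have uw: "u \<in> carrier R" "w \<in> carrier R" using facts by (simp_all add: u_def w_def)
  have mults: "u \<otimes> f = f" "u \<otimes> z = e" "w \<otimes> f = f" "u \<otimes> w = \<one>" "u \<otimes> e = x" "w \<otimes> e = z"
    using facts by (simp_all add: u_def w_def l_distr r_distr)
  have u0: "u \<noteq> \<zero>" "w \<noteq> \<zero>" using mults facts by auto
  \<comment> \<open>Products with \<open>e\<close> and \<open>f\<close> tell these elements apart:
    \<open>z\<close> has no part in the corner of \<open>f\<close>, and \<open>f\<close> none in
    that of \<open>e\<close>.\<close>
  have ne: "u \<noteq> f" "u \<noteq> z" "w \<noteq> f" "w \<noteq> z" "z \<noteq> f"
    using mults facts z0 by auto
  have "u = w"
  proof (rule ccontr)
    assume uw_ne: "u \<noteq> w"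
    \<comment> \<open>If \<open>u\<close> and its inverse \<open>w\<close> differ, then
      \<open>w\<close>, \<open>z\<close> and \<open>f\<close> are three neighbours of
      \<open>u\<close>, against the degree bound.\<close>
    have "f \<otimes> u \<otimes> f = f" "z \<otimes> u \<otimes> z = z" "u \<otimes> w \<otimes> u = u"
      using mults facts uw by (simp_all add: m_comm)
    then have "{w, z, f} \<subseteq> nbrs (reg_graph R) u"
      using uw uw_ne u0 z0 ne facts by (auto simp: nbrs_reg_graph)
    then have "card {w, z, f} \<le> 2"
      using deg[OF uw(1) u0(1)] card_mono[OF finite_nbrs[OF fin]] le_trans by blast
    then show False using ne by simp
  qed
  then have "x = z" using mults by auto
  then show ?thesis using xz by simp
qed

text \<open>Not only a nonzero \<open>x\<close> but also a nonzero \<open>d = x \<ominus> e\<close>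
  squares to \<open>e\<close>. Hence \<open>d\<close> can be cancelled from
  \<open>d \<otimes> (x \<oplus> e) = \<zero>\<close>, with no appeal to the corner being a
  domain.\<close>

lemma corner_subset_signs:
  assumes fin: "finite (carrier R)" and vnr: "von_neumann_regular R"
    and deg: "\<And>v. v \<in> carrier R \<Longrightarrow> v \<noteq> \<zero> \<Longrightarrow> card (nbrs (reg_graph R) v) \<le> 2"
    and e: "e \<in> carrier R" "e \<otimes> e = e" and f: "f \<in> carrier R" "f \<otimes> f = f" "f \<noteq> \<zero>"
    and ef: "e \<otimes> f = \<zero>" "e \<oplus> f = \<one>"
    and idem: "\<And>p. p \<in> carrier R \<Longrightarrow> p \<otimes> p = p \<Longrightarrow> p \<in> {\<zero>, \<one>, e, f}"
    and y: "y \<in> carrier R"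
  shows "y \<otimes> e \<in> {\<zero>, e, \<ominus> e}"
proof -
  note inv = corner_involution[OF fin vnr deg e f ef idem]
  define x where "x = y \<otimes> e"
  have x: "x \<in> carrier R" "x \<otimes> e = x" using y e by (simp_all add: x_def m_assoc)
  have "x = \<ominus> e" if "x \<noteq> \<zero>" "x \<noteq> e"
  proof -
    define d where "d = x \<ominus> e"
    have d: "d \<in> carrier R" "d \<otimes> e = d" "d \<noteq> \<zero>"
      using x e that by (simp_all add: d_def minus_eq l_distr l_minus) (metis minus_eq r_right_minus_eq)
    have "x \<otimes> x = e" using inv x that by blast
    then have "d \<otimes> (x \<oplus> e) = \<zero>"
      using x e by (simp add: d_def minus_eq l_distr r_distr l_minus r_minus m_comm[of e x] a_assoc)
        (metis a_inv_closed add.m_assoc add.r_inv l_neg l_zero)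
    then have "d \<otimes> d \<otimes> (x \<oplus> e) = \<zero>" using d x e by (simp add: m_assoc)
    moreover have "d \<otimes> d = e" using inv d by blast
    ultimately have "e \<otimes> (x \<oplus> e) = \<zero>" by simp
    then have "x \<oplus> e = \<zero>" using x e by (simp add: r_distr m_comm)
    then show ?thesis using x e by (metis minus_equality)
  qed
  then show ?thesis by (auto simp: x_def)
qed

lemma iso_product_of_degrees_1_or_2:
  assumes fin: "finite (carrier R)" and vnr: "von_neumann_regular R"
    and ne: "carrier R - {\<zero>} \<noteq> {}"
    and deg: "\<And>v. v \<in> carrier R \<Longrightarrow> v \<noteq> \<zero> \<Longrightarrow> card (nbrs (reg_graph R) v) \<in> {1, 2}"
  shows "R \<simeq> RDirProd (residue_ring 2) (residue_ring 2) \<or>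
    R \<simeq> RDirProd (residue_ring 2) (residue_ring 3) \<or>
    R \<simeq> RDirProd (residue_ring 3) (residue_ring 3)"
proof -
  have 1: "\<one> \<noteq> \<zero>" using ne one_zeroD by auto
  have deg2: "card (nbrs (reg_graph R) v) \<le> 2" if "v \<in> carrier R" "v \<noteq> \<zero>" for v
    using deg[OF that] by auto
  \<comment> \<open>The lower degree bound is used here: it supplies the idempotent that splits the
    ring.\<close>
  have "nbrs (reg_graph R) \<one> \<noteq> {}" using deg[of \<one>] 1 by auto
  then obtain e where e: "e \<in> carrier R" "e \<otimes> e = e" "e \<noteq> \<zero>" "e \<noteq> \<one>"
    by (auto simp: nbrs_one)
  define f where "f = \<one> \<ominus> e"
  note c = complement_idempotent[OF e(1,2), folded f_def]
  have f: "f \<in> carrier R" "f \<otimes> f = f" "f \<noteq> \<zero>" "f \<noteq> \<one>" "e \<noteq> f"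
    using c e by auto
  have fe: "f \<otimes> e = \<zero>" "f \<oplus> e = \<one>" using c e by (simp_all add: m_comm a_comm)
  \<comment> \<open>Any other idempotent would be a third neighbour of 1 besides \<open>e\<close>
    and \<open>f\<close>.\<close>
  have idem: "p \<in> {\<zero>, \<one>, e, f}" if p: "p \<in> carrier R" "p \<otimes> p = p" for p
  proof (rule ccontr)
    assume "p \<notin> {\<zero>, \<one>, e, f}"
    then have "{e, f, p} \<subseteq> nbrs (reg_graph R) \<one>" "card {e, f, p} = 3"
      using p e f by (auto simp: nbrs_one)
    then show False
      using card_mono[OF finite_nbrs[OF fin], of "{e, f, p}" \<one>] deg2[of \<one>] 1 by auto
  qed
  have idem': "p \<in> {\<zero>, \<one>, f, e}" if "p \<in> carrier R" "p \<otimes> p = p" for p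
    using idem[OF that] by blast
  note se = corner_subset_signs[OF fin vnr deg2 e(1,2) f(1,2,3) c(3,4) idem]
  note sf = corner_subset_signs[OF fin vnr deg2 f(1,2) e(1,2,3) fe idem']
  \<comment> \<open>When the double of \<open>d\<close> vanishes, \<open>\<ominus> d\<close> equals
    \<open>d\<close> and the corner has only two elements.\<close>
  have F2: "\<exists>h. corner_hom R d (residue_ring 2) h"
    if "d \<in> carrier R" "d \<otimes> d = d" "d \<noteq> \<zero>" "d \<oplus> d = \<zero>"
      "\<And>y. y \<in> carrier R \<Longrightarrow> y \<otimes> d \<in> {\<zero>, d, \<ominus> d}" for d
    using corner_hom_F2[OF that(1-4)] that minus_equality[of d d] by auto
  have dich: "(\<exists>h. corner_hom R d (residue_ring 2) h) \<or> (\<exists>h. corner_hom R d (residue_ring 3) h)"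
    if "d \<in> carrier R" "d \<otimes> d = d" "d \<noteq> \<zero>"
      "\<And>y. y \<in> carrier R \<Longrightarrow> y \<otimes> d \<in> {\<zero>, d, \<ominus> d}" for d
    using F2[OF that(1-3) _ that(4)] corner_hom_F3[OF that(1-3) _ that(4)] by blast
  \<comment> \<open>Both orders of the factors are needed: when \<open>e\<close> gives 3 elements
    and \<open>f\<close> gives 2, \<open>Q\<close> puts the smaller field first.\<close>
  note P = corner_hom_one[OF corner_hom_prod[OF _ _ e(1,2) f(1,2) c(3), unfolded c(4)]]
  note Q = corner_hom_one[OF corner_hom_prod[OF _ _ f(1,2) e(1,2) fe(1), unfolded fe(2)]]
  show ?thesis
    using dich[OF e(1-3) se] dich[OF f(1-3) sf] P Q by blast
qed

section \<open>Boolean rings and the wheel\<close>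

lemma boolean_double:
  assumes bool: "\<And>x. x \<in> carrier R \<Longrightarrow> x \<otimes> x = x" and x: "x \<in> carrier R"
  shows "x \<oplus> x = \<zero>"
proof -
  \<comment> \<open>Squaring the double of \<open>x\<close> yields four copies of \<open>x\<close>,
    while idempotence yields two; cancelling gives the claim.\<close>
  have "(x \<oplus> x) \<oplus> (x \<oplus> x) = (x \<oplus> x) \<otimes> (x \<oplus> x)"
    using x bool[OF x] by (simp add: l_distr r_distr)
  also have "\<dots> = x \<oplus> x" by (rule bool) (use x in simp)
  finally show ?thesis using x add.l_cancel_one[of "x \<oplus> x" "x \<oplus> x"] by auto
qed

text \<open>An element \<open>x\<close> strictly between 0 and \<open>a\<close> would be a fourth
  neighbour of \<open>a\<close>, besides 1 and the two sums \<open>a \<oplus> b\<close> and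
  \<open>a \<oplus> c\<close>.\<close>

lemma boolean_atom:
  assumes fin: "finite (carrier R)" and bool: "\<And>x. x \<in> carrier R \<Longrightarrow> x \<otimes> x = x"
    and a: "a \<in> carrier R" "a \<noteq> \<zero>" and b: "b \<in> carrier R" "b \<noteq> \<zero>" and c: "c \<in> carrier R" "c \<noteq> \<zero>"
    and orth: "a \<otimes> b = \<zero>" "a \<otimes> c = \<zero>" "b \<otimes> c = \<zero>"
    and deg: "card (nbrs (reg_graph R) a) \<le> 3" and y: "y \<in> carrier R"
  shows "y \<otimes> a \<in> {\<zero>, a}"
proof (rule ccontr)
  define x where "x = y \<otimes> a"
  assume "y \<otimes> a \<notin> {\<zero>, a}"
  then have x: "x \<in> carrier R" "x \<noteq> \<zero>" "x \<noteq> a" "x \<otimes> a = x"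
    using y a by (auto simp: x_def m_assoc bool)
  have orth': "b \<otimes> a = \<zero>" "c \<otimes> a = \<zero>" "c \<otimes> b = \<zero>" "x \<otimes> b = \<zero>" "x \<otimes> c = \<zero>"
    "b \<otimes> x = \<zero>" "c \<otimes> x = \<zero>"
    using a b c x orth by (metis m_comm m_assoc r_null)+
  note facts = a b c x orth orth' bool
  have ab: "(a \<oplus> b) \<otimes> a = a" "(a \<oplus> b) \<otimes> b = b" "(a \<oplus> b) \<otimes> c = \<zero>"
    and ac: "(a \<oplus> c) \<otimes> a = a" "(a \<oplus> c) \<otimes> b = \<zero>" "(a \<oplus> c) \<otimes> c = c"
    using facts by (simp_all add: l_distr)
  have car: "a \<oplus> b \<in> carrier R" "a \<oplus> c \<in> carrier R" using facts by auto
  \<comment> \<open>The products with \<open>b\<close> and \<open>c\<close> separate the four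
    elements: they are \<open>b, c\<close> for 1, then \<open>b, \<zero>\<close>, then
    \<open>\<zero>, c\<close>, and \<open>\<zero>, \<zero>\<close> for \<open>x\<close>.\<close>
  have dist: "card {\<one>, a \<oplus> b, a \<oplus> c, x} = 4"
  proof -
    have "\<one> \<noteq> a \<oplus> b" using ab(3) c l_one by metis
    moreover have "\<one> \<noteq> a \<oplus> c" using ac(2) b l_one by metis
    moreover have "\<one> \<noteq> x" using orth'(4) b l_one by metis
    moreover have "a \<oplus> b \<noteq> a \<oplus> c" using ab(3) ac(3) c by metis
    moreover have "a \<oplus> b \<noteq> x" using ab(2) orth'(4) b by metis
    moreover have "a \<oplus> c \<noteq> x" using ac(3) orth'(5) c by metis
    ultimately show ?thesis by auto
  qed
  have "{\<one>, a \<oplus> b, a \<oplus> c, x} \<subseteq> nbrs (reg_graph R) a"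
  proof -
    have "\<one> \<noteq> \<zero>" using a one_zeroD by auto
    moreover have "\<one> \<noteq> a" using orth(1) b l_one by metis
    moreover have "a \<oplus> b \<noteq> a" using ab(2) orth(1) b by metis
    moreover have "a \<oplus> c \<noteq> a" using ac(3) orth(2) c by metis
    moreover have "a \<oplus> b \<noteq> \<zero>" "a \<oplus> c \<noteq> \<zero>" using ab(1) ac(1) a l_null by metis+
    moreover have "a \<otimes> (a \<oplus> b) \<otimes> a = a" "a \<otimes> (a \<oplus> c) \<otimes> a = a"
      using a ab(1) ac(1) car bool m_assoc by metis+
    moreover have "x \<otimes> a \<otimes> x = x" using x bool by simp
    ultimately show ?thesis using facts car by (auto simp: nbrs_reg_graph)
  qed
  then have "4 \<le> card (nbrs (reg_graph R) a)"
    using card_mono[OF finite_nbrs[OF fin]] dist by metis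
  then show False using deg by simp
qed

lemma iso_product_of_wheel:
  assumes fin: "finite (carrier R)" and wheel: "is_wheel_graph (reg_graph R)"
  shows "R \<simeq> RDirProd (residue_ring 2) (RDirProd (residue_ring 2) (residue_ring 2))"
proof -
  let ?N = "nbrs (reg_graph R)"
  obtain h where h: "h \<in> carrier R" "h \<noteq> \<zero>" "\<And>v. v \<in> carrier R \<Longrightarrow> v \<noteq> \<zero> \<Longrightarrow> v \<noteq> h \<Longrightarrow> v \<in> ?N h"
    "card (?N h) \<ge> 3"
    and deg: "\<And>v. v \<in> carrier R \<Longrightarrow> v \<noteq> \<zero> \<Longrightarrow> v \<noteq> h \<Longrightarrow> card (?N v) = 3"
    using wheel_graph_degrees[OF wheel parcs_subset_pverts(4)] by (auto simp: reg_graph_def)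
  have 1: "\<one> \<noteq> \<zero>" using h(1,2) one_zeroD by auto
  \<comment> \<open>Hub and rim vertices alike have at least 3 neighbours, so this holds before the
    hub is located.\<close>
  have deg1: "card (?N \<one>) \<ge> 3" using h(4) deg[OF one_closed 1] by (cases "\<one> = h") simp_all
  then have "?N \<one> \<noteq> {}" by auto
  then obtain e where e: "e \<in> carrier R" "e \<otimes> e = e" "e \<noteq> \<zero>" "e \<noteq> \<one>"
    by (auto simp: nbrs_one)
  define f where "f = \<one> \<ominus> e"
  note c = complement_idempotent[OF e(1,2), folded f_def]
  have f: "f \<in> carrier R" "f \<otimes> f = f" "f \<noteq> \<zero>" "f \<noteq> \<one>" "e \<noteq> f" using c e by auto
  have "\<not> ?N \<one> \<subseteq> {e, f}"
    using deg1 card_mono[of "{e, f}" "?N \<one>"] f by auto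
  then obtain g where g: "g \<in> carrier R" "g \<otimes> g = g" "g \<noteq> \<zero>" "g \<noteq> \<one>" "g \<noteq> e" "g \<noteq> f"
    by (auto simp: nbrs_one)
  define k where "k = \<one> \<ominus> g"
  note d = complement_idempotent[OF g(1,2), folded k_def]
  \<comment> \<open>Complementation is an involution exchanging \<open>e\<close> and
    \<open>f\<close>, so \<open>g\<close> outside this pair has its complement outside too; and
    \<open>k = g\<close> would make \<open>g \<otimes> g\<close> zero.\<close>
  have k: "k \<in> carrier R" "k \<otimes> k = k" "k \<noteq> \<zero>" "k \<noteq> \<one>" "k \<noteq> e" "k \<noteq> f" "k \<noteq> g"
    using d g c unfolding f_def k_def by auto
  have "{e, f, g, k} \<subseteq> ?N \<one>" using e f g k by (auto simp: nbrs_one)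
  then have "card {e, f, g, k} \<le> card (?N \<one>)" by (rule card_mono[OF finite_nbrs[OF fin]])
  moreover have "card {e, f, g, k} = 4" using f g k by auto
  \<comment> \<open>Every vertex other than the hub has exactly 3 neighbours, while 1 has at least
    4.\<close>
  ultimately have h1: "h = \<one>" using deg[of \<one>] 1 by fastforce
  have bool: "x \<otimes> x = x" if "x \<in> carrier R" for x
  proof (cases "x = \<zero> \<or> x = \<one>")
    case False
    then show ?thesis using h(3)[OF that] h1 by (auto simp: nbrs_one)
  qed auto
  note dbl = boolean_double[OF bool]
  \<comment> \<open>A chain \<open>\<zero> < p < q < \<one>\<close> of the Boolean algebra, where
    \<open>p \<otimes> q = p\<close> means that \<open>p\<close> lies below \<open>q\<close>.
    Depending on \<open>e \<otimes> g\<close>, it is \<open>e\<close> below \<open>k\<close>,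
    \<open>e\<close> below \<open>g\<close>, or \<open>e \<otimes> g\<close> below
    \<open>e\<close>.\<close>
  have "\<exists>p q. p \<in> carrier R \<and> q \<in> carrier R \<and> p \<noteq> \<zero> \<and> q \<noteq> \<one> \<and> p \<noteq> q \<and> p \<otimes> q = p"
  proof (cases "e \<otimes> g = \<zero>")
    case True
    then have "e \<otimes> k = e" using e g by (simp add: k_def minus_eq r_distr r_minus)
    then show ?thesis using e k by blast
  next
    case False
    then show ?thesis using e g
      by (cases "e \<otimes> g = e") (blast, metis m_assoc m_closed m_comm)
  qed
  then obtain p q where pq: "p \<in> carrier R" "q \<in> carrier R" "p \<noteq> \<zero>" "q \<noteq> \<one>" "p \<noteq> q" "p \<otimes> q = p"
    by blast
  \<comment> \<open>\<open>b\<close> and \<open>r\<close> are the differences \<open>q - p\<close>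
    and \<open>1 - q\<close>, written as sums because doubles vanish. So \<open>p\<close>,
    \<open>b\<close> and \<open>r\<close> partition 1.\<close>
  define b where "b = q \<oplus> p"
  define r where "r = \<one> \<oplus> q"
  have b: "b \<in> carrier R" "b \<noteq> \<zero>" and r: "r \<in> carrier R" "r \<noteq> \<zero>"
    using pq dbl by (simp_all add: b_def r_def) (metis add.l_cancel a_comm one_closed)+
  have orth: "p \<otimes> b = \<zero>" "p \<otimes> r = \<zero>" "b \<otimes> r = \<zero>"
    using pq dbl bool by (simp_all add: b_def r_def l_distr r_distr m_comm[of q p] a_ac)
  have orth': "b \<otimes> p = \<zero>" "r \<otimes> p = \<zero>" "r \<otimes> b = \<zero>"
    using orth pq b r by (simp_all add: m_comm)
  have sum: "p \<oplus> (b \<oplus> r) = \<one>"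
  proof -
    have "p \<oplus> (b \<oplus> r) = (p \<oplus> p) \<oplus> ((q \<oplus> q) \<oplus> \<one>)"
      unfolding b_def r_def using pq by (simp add: a_ac)
    then show ?thesis using pq dbl by simp
  qed
  \<comment> \<open>A nonzero member orthogonal to another nonzero one is not 1, hence not the hub,
    and so has degree 3.\<close>
  have atom: "\<exists>h. corner_hom R a (residue_ring 2) h"
    if a: "a \<in> carrier R" "a \<noteq> \<zero>" "a' \<in> carrier R" "a' \<noteq> \<zero>" "a'' \<in> carrier R" "a'' \<noteq> \<zero>"
      "a \<otimes> a' = \<zero>" "a \<otimes> a'' = \<zero>" "a' \<otimes> a'' = \<zero>" for a a' a''
  proof (rule corner_hom_F2)
    have "a \<noteq> \<one>" using a by auto
    then show "y \<otimes> a \<in> {\<zero>, a}" if "y \<in> carrier R" for y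
      using boolean_atom[OF fin bool a _ that] deg[of a] a h1 by simp
  qed (use a bool dbl in auto)
  obtain h1 h2 h3 where hom: "corner_hom R p (residue_ring 2) h1"
    "corner_hom R b (residue_ring 2) h2" "corner_hom R r (residue_ring 2) h3"
    using atom[OF pq(1,3) b r orth] atom[OF b pq(1,3) r orth'(1) orth(3,2)]
      atom[OF r pq(1,3) b orth'(2,3) orth(1)] by blast
  \<comment> \<open>The corners of \<open>b\<close> and \<open>r\<close> are joined first, to match
    the bracketing of the triple product.\<close>
  have br: "b \<oplus> r \<in> carrier R" "p \<otimes> (b \<oplus> r) = \<zero>"
    using b r pq orth by (simp_all add: r_distr)
  note hom_br = corner_hom_prod[OF hom(2,3) b(1) bool[OF b(1)] r(1) bool[OF r(1)] orth(3)]
  show ?thesis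
    using corner_hom_prod[OF hom(1) hom_br pq(1) bool[OF pq(1)] br(1) bool[OF br(1)] br(2)]
    unfolding sum by (rule corner_hom_one)
qed

end

section \<open>The classification\<close>

theorem theorem10:
  fixes R :: "('a, 'm) ring_scheme"
  assumes "cring R" and "finite (carrier R)" and "von_neumann_regular R"
  shows "(is_path_graph (reg_graph R) \<longleftrightarrow>
            R \<simeq> RDirProd (residue_ring 2) (residue_ring 2) \<or>
            R \<simeq> RDirProd (residue_ring 2) (residue_ring 3)) \<and>
         (is_cycle_graph (reg_graph R) \<longleftrightarrow>
            R \<simeq> RDirProd (residue_ring 3) (residue_ring 3)) \<and>
         (is_wheel_graph (reg_graph R) \<longleftrightarrow>
            R \<simeq> RDirProd (residue_ring 2) (RDirProd (residue_ring 2) (residue_ring 2)))"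
proof -
  interpret cring R by fact
  let ?G = "reg_graph R"
  have V: "pverts ?G = carrier R - {\<zero>\<^bsub>R\<^esub>}" by (simp add: reg_graph_def)
  note products = reg_graph_of_products[OF ring_axioms]
  \<comment> \<open>Paths and cycles alike have a vertex and only degrees 1 and 2, so one
    classification serves both.\<close>
  have "R \<simeq> RDirProd (residue_ring 2) (residue_ring 2) \<or>
      R \<simeq> RDirProd (residue_ring 2) (residue_ring 3) \<or>
      R \<simeq> RDirProd (residue_ring 3) (residue_ring 3)" if "is_path_graph ?G \<or> is_cycle_graph ?G"
  proof (rule iso_product_of_degrees_1_or_2[OF assms(2,3)])
    show "carrier R - {\<zero>\<^bsub>R\<^esub>} \<noteq> {}"
      using that path_graph_degrees(2)[of ?G] cycle_graph_degrees(2)[of ?G] parcs_subset_pverts(4) V by auto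
    show "card (nbrs ?G v) \<in> {1, 2}" if "v \<in> carrier R" "v \<noteq> \<zero>\<^bsub>R\<^esub>" for v
      using that \<open>is_path_graph ?G \<or> is_cycle_graph ?G\<close> path_graph_degrees(1)[of ?G v]
        cycle_graph_degrees(1)[of ?G v] parcs_subset_pverts(4) V by auto
  qed
  \<comment> \<open>By \<open>products\<close> each of the three rings has a path or a cycle as its
    graph; since no graph is both, the kind of graph decides which rings remain.\<close>
  moreover have "\<not> (is_path_graph ?G \<and> is_cycle_graph ?G)"
    using not_path_and_cycle parcs_subset_pverts(4) by blast
  ultimately show ?thesis
    using products iso_product_of_wheel[OF assms(2)] by blast
qed

end
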